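(* For every finite connected graph $G=(V,E)$ (with $V \neq \emptyset$), the number $\min_{v \in V} f_d(G,v)$ equals the minimum cardinality of a closed set in $G$.
   Context: $\mathrm{dist}(u,v)$ denotes the length of a shortest path between $u$ and $v$ in $G$. Explorer-Director game on $G$ with starting vertex $v$: a token is initially at $v$ (so $v$ counts as visited). On each turn the Explorer names a distance $d$ such that at least one vertex of $G$ is at distance exactly $d$ from the token's current position, and then the Director moves the token to a vertex of their choice at distance exactly $d$ from the current position. The Explorer wants to maximize, and the Director to minimize, the number of distinct vertices visited by the token; play continues until the Explorer can no longer force the token onto an unvisited vertex. $f_d(G,v)$ is the number of visited vertices at the end of the game under optimal play by both players; equivalently, it is the largest $k$ such that the Explorer has a (possibly adaptive) strategy guaranteeing, against every play of the Director, that at least $k$ distinct vertices (including $v$) are visited after finitely many turns. Closed set: a non-empty subset $U \subseteq V$ is closed if for every $u \in U$ and every $v \in V$ there exists $x \in U$ with $\mathrm{dist}(u,v)=\mathrm{dist}(u,x)$, where distances are computed in $G$. *)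

theory Defs
  imports "Graph_Theory.Digraph_Component" "Graph_Theory.Arc_Walk"
begin

text \<open>
  A finite simple undirected graph is an instance of the locale \<open>graph\<close>: a finite
  symmetric digraph without loops or parallel arcs, each undirected edge being a pair of
  opposite arcs.  The number of arcs of a path is therefore its number of undirected edges.
  The value below is meaningful only if some path joins the two vertices, which
  always holds for vertices of a connected graph.
\<close>

definition vertex_dist :: "('a, 'b) pre_digraph \<Rightarrow> 'a \<Rightarrow> 'a \<Rightarrow> nat" where
  "vertex_dist G u v = (LEAST n. \<exists>p. pre_digraph.apath G u p v \<and> length p = n)"

text \<open>
  An Explorer strategy maps the history, i.e. the nonempty list of all positions so far with
  the current position last, to the distance named next.  The distances named earlier need
  not be recorded, since they are the distances between consecutive positions.
\<close>

definition explorer_strategy :: "('a, 'b) pre_digraph \<Rightarrow> ('a list \<Rightarrow> nat) \<Rightarrow> bool" where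
  "explorer_strategy G \<sigma> \<longleftrightarrow>
     (\<forall>h. h \<noteq> [] \<and> set h \<subseteq> verts G \<longrightarrow>
        (\<exists>w \<in> verts G. vertex_dist G (last h) w = \<sigma> h))"

text \<open>
  The plays compatible with a strategy, over all choices of the Director; \<open>p i\<close> is
  the position of the token after \<open>i\<close> turns.  Plays are continued for ever, which is
  harmless because only the vertices visited after finitely many turns are counted.
\<close>

definition director_play ::
    "('a, 'b) pre_digraph \<Rightarrow> ('a list \<Rightarrow> nat) \<Rightarrow> 'a \<Rightarrow> (nat \<Rightarrow> 'a) \<Rightarrow> bool" where
  "director_play G \<sigma> v p \<longleftrightarrow>
     p 0 = v \<and>
     (\<forall>i. p (Suc i) \<in> verts G \<and>
          vertex_dist G (p i) (p (Suc i)) = \<sigma> (map p [0..<Suc i]))"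

definition explorer_guarantees :: "('a, 'b) pre_digraph \<Rightarrow> 'a \<Rightarrow> nat \<Rightarrow> bool" where
  "explorer_guarantees G v k \<longleftrightarrow>
     (\<exists>\<sigma>. explorer_strategy G \<sigma> \<and>
        (\<forall>p. director_play G \<sigma> v p \<longrightarrow> (\<exists>n. k \<le> card (p ` {..n}))))"

definition f_d :: "('a, 'b) pre_digraph \<Rightarrow> 'a \<Rightarrow> nat" where
  "f_d G v = Max {k. explorer_guarantees G v k}"

definition closed_set :: "('a, 'b) pre_digraph \<Rightarrow> 'a set \<Rightarrow> bool" where
  "closed_set G U \<longleftrightarrow>
     U \<noteq> {} \<and> U \<subseteq> verts G \<and>
     (\<forall>u \<in> U. \<forall>v \<in> verts G. \<exists>x \<in> U. vertex_dist G u v = vertex_dist G u x)"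

end

theory Submission
  imports Defs
begin

text \<open>
  A Director starting in a closed set can stay inside it.  Conversely, if the set \<open>W\<close> of visited
  vertices contains no closed set, then repeatedly removing from \<open>W\<close> a vertex that violates
  closedness exhausts \<open>W\<close>.  If the Explorer always names the distance witnessing the violation, the
  token either leaves \<open>W\<close> or moves to a vertex removed earlier, so it has to leave \<open>W\<close> eventually.
\<close>

lemma closed_set_verts: "verts G \<noteq> {} \<Longrightarrow> closed_set G (verts G)"
  by (auto simp: closed_set_def)

text \<open>Closedness lets the Director answer every legal distance named at a vertex of
  \<open>U\<close> by a vertex of \<open>U\<close>, so against any strategy some play never leaves
  \<open>U\<close>.\<close>

lemma explorer_guarantees_le_card_closed:
  assumes "closed_set G U" "finite U" "v \<in> U" "explorer_guarantees G v k"
  shows "k \<le> card U"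
proof -
  obtain \<sigma> where strat: "explorer_strategy G \<sigma>"
    and reach: "\<And>p. director_play G \<sigma> v p \<Longrightarrow> \<exists>n. k \<le> card (p ` {..n})"
    using assms(4) by (auto simp: explorer_guarantees_def)
  have UV: "U \<subseteq> verts G"
    using assms(1) by (simp add: closed_set_def)
  have "\<exists>x \<in> U. vertex_dist G (last h) x = \<sigma> h" if h: "h \<noteq> []" "set h \<subseteq> U" for h
  proof -
    obtain w where w: "w \<in> verts G" "vertex_dist G (last h) w = \<sigma> h"
      using strat h UV unfolding explorer_strategy_def by (meson subset_trans)
    have "last h \<in> U"
      using h by auto
    then show ?thesis
      using assms(1) w unfolding closed_set_def by metis
  qed
  then obtain c where c: "\<And>h. h \<noteq> [] \<Longrightarrow> set h \<subseteq> U \<Longrightarrow> c h \<in> U"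
    "\<And>h. h \<noteq> [] \<Longrightarrow> set h \<subseteq> U \<Longrightarrow> vertex_dist G (last h) (c h) = \<sigma> h"
    by metis
  \<comment> \<open>The reply \<open>c\<close> depends on the whole history, so the recursion builds
    histories; the play reads off their last entries. \<open>H n\<close> has n + 1 entries, as
    \<open>director_play\<close> requires.\<close>
  define H where "H = rec_nat [v] (\<lambda>_ h. h @ [c h])"
  define p where "p n = last (H n)" for n
  have H0: "H 0 = [v]" and HS: "H (Suc n) = H n @ [c (H n)]" for n
    by (simp_all add: H_def)
  have HU: "H n \<noteq> [] \<and> set (H n) \<subseteq> U" for n
    by (induction n) (use assms(3) c(1) in \<open>auto simp: H0 HS\<close>)
  have Hp: "map p [0..<Suc n] = H n" for n
    by (induction n) (auto simp: H0 HS p_def)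
  have pU: "p n \<in> U" for n
    using HU[of n] last_in_set unfolding p_def by blast
  have "director_play G \<sigma> v p"
    unfolding director_play_def Hp
    using HU c pU UV by (auto simp: p_def H0 HS)
  then obtain n where "k \<le> card (p ` {..n})"
    using reach by blast
  also have "\<dots> \<le> card U"
    using pU assms(2) by (intro card_mono) auto
  finally show ?thesis .
qed

text \<open>Here \<open>r\<close> records the order of removal and \<open>s u\<close> the distance
  that violates closedness when \<open>u\<close> is removed. Naming \<open>s u\<close> at
  \<open>u\<close> thus makes the rank drop for as long as the token stays in
  \<open>W\<close>.\<close>

lemma exists_decreasing_rank:
  assumes "finite W" "W \<subseteq> verts G" "\<And>U. U \<subseteq> W \<Longrightarrow> \<not> closed_set G U"
  shows "\<exists>r s. \<forall>u \<in> W. (\<exists>w \<in> verts G. vertex_dist G u w = s u) \<and>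
    (\<forall>x \<in> W. vertex_dist G u x = s u \<longrightarrow> (r x :: nat) < r u)"
  using assms
proof (induction W rule: finite_psubset_induct)
  case (psubset W)
  show ?case
  proof (cases "W = {}")
    case False
    have "\<not> closed_set G W"
      using psubset.prems by blast
    then obtain u w where u: "u \<in> W" and w: "w \<in> verts G"
      and esc: "\<And>x. x \<in> W \<Longrightarrow> vertex_dist G u x \<noteq> vertex_dist G u w"
      using False psubset.prems(1) unfolding closed_set_def by metis
    have "W - {u} \<subset> W" "W - {u} \<subseteq> verts G" "\<And>U. U \<subseteq> W - {u} \<Longrightarrow> \<not> closed_set G U"
      using u psubset.prems by blast+
    then obtain r s where rs: "\<forall>y \<in> W - {u}. (\<exists>w \<in> verts G. vertex_dist G y w = s y) \<and>
        (\<forall>x \<in> W - {u}. vertex_dist G y x = s y \<longrightarrow> (r x :: nat) < r y)"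
      using psubset.IH[of "W - {u}"] by blast
    show ?thesis
      \<comment> \<open>The vertex \<open>u\<close> goes first: no vertex of \<open>W\<close> is at
        its distance, so it takes rank 0. Shifting all other ranks up keeps their descent valid even
        for moves to \<open>u\<close>.\<close>
      by (rule exI[of _ "\<lambda>y. if y = u then 0 else Suc (r y)"],
          rule exI[of _ "s(u := vertex_dist G u w)"]) (use rs w esc in auto)
  qed auto
qed

text \<open>A visited set with fewer than \<open>m\<close> elements contains no closed set, so a
  decreasing rank exists on it and forces the token out. This repeats until \<open>m\<close>
  vertices are visited.\<close>

lemma explorer_guarantees_if_no_smaller_closed:
  assumes fin: "finite (verts G)" and v: "v \<in> verts G"
    and large: "\<And>U. closed_set G U \<Longrightarrow> m \<le> card U"
  shows "explorer_guarantees G v m"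
proof -
  have "\<exists>r s. \<forall>u \<in> W. (\<exists>w \<in> verts G. vertex_dist G u w = s u) \<and>
      (\<forall>x \<in> W. vertex_dist G u x = s u \<longrightarrow> (r x :: nat) < r u)"
    if W: "W \<subseteq> verts G" "card W < m" for W
  proof (rule exists_decreasing_rank)
    show "finite W"
      using W(1) fin finite_subset by blast
    then show "\<not> closed_set G U" if "U \<subseteq> W" for U
      using that W(2) large[of U] card_mono[of W U] by auto
  qed (fact W(1))
  then obtain r s where
    s: "\<And>W u. W \<subseteq> verts G \<Longrightarrow> card W < m \<Longrightarrow> u \<in> W \<Longrightarrow> \<exists>w \<in> verts G. vertex_dist G u w = s W u"
    and r: "\<And>W u x. W \<subseteq> verts G \<Longrightarrow> card W < m \<Longrightarrow> u \<in> W \<Longrightarrow> x \<in> W \<Longrightarrow>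
      vertex_dist G u x = s W u \<Longrightarrow> (r W x :: nat) < r W u"
    by metis
  \<comment> \<open>Rank and distances are chosen anew for each visited set. Once \<open>m\<close>
    vertices are visited the distance to \<open>v\<close> serves as an arbitrary legal
    default.\<close>
  define \<sigma> where "\<sigma> h = (if card (set h) < m then s (set h) (last h) else vertex_dist G (last h) v)"
    for h
  have "explorer_strategy G \<sigma>"
    unfolding explorer_strategy_def \<sigma>_def using s v by auto
  moreover have "\<exists>n. m \<le> card (p ` {..n})" if play: "director_play G \<sigma> v p" for p
  proof -
    have pV: "p i \<in> verts G" for i
      using play v by (cases i) (auto simp: director_play_def)
    have step: "vertex_dist G (p i) (p (Suc i)) = \<sigma> (map p [0..<Suc i])" for i
      using play by (simp add: director_play_def)
    have set_hist: "set (map p [0..<Suc i]) = p ` {..i}" for i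
      by (simp only: set_map set_upt atLeast0LessThan lessThan_Suc_atMost)
    have new: "\<exists>j. p j \<notin> p ` {..i}" if small: "card (p ` {..i}) < m" for i
    proof (rule ccontr)
      assume stay: "\<nexists>j. p j \<notin> p ` {..i}"
      define W where "W = p ` {..i}"
      \<comment> \<open>With the visited set frozen at \<open>W\<close>, the same rank function
        governs all later turns, and the ranks of the positions would descend forever in the
        naturals.\<close>
      have "p ` {..i + j} = W" for j
        using stay unfolding W_def by fastforce
      then have "\<sigma> (map p [0..<Suc (i + j)]) = s W (p (i + j))" for j
        using small unfolding \<sigma>_def set_hist by (simp add: W_def)
      then have "r W (p (Suc (i + j))) < r W (p (i + j))" for j
        using r[of W "p (i + j)" "p (Suc (i + j))"] stay small pV step[of "i + j"]
        unfolding W_def by auto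
      then show False
        using wf_less_than wf_iff_no_infinite_down_chain[of less_than]
        by (auto dest!: spec[of _ "\<lambda>j. r W (p (i + j))"])
    qed
    \<comment> \<open>The bound \<open>k \<le> m\<close> settles the case where \<open>new\<close>
      does not apply, since then at least \<open>m\<close> vertices are already visited.\<close>
    have "\<exists>n. k \<le> card (p ` {..n})" if "k \<le> m" for k
      using that
    proof (induction k)
      case (Suc k)
      then obtain n where n: "k \<le> card (p ` {..n})"
        by auto
      show ?case
      proof (cases "card (p ` {..n}) < m")
        case True
        then obtain j where j: "p j \<notin> p ` {..n}"
          using new by blast
        have "Suc k \<le> card (insert (p j) (p ` {..n}))"
          using n j by simp
        also have "\<dots> \<le> card (p ` {..max n j})"
          by (intro card_mono) auto
        finally show ?thesis
          by blast
      next
        case False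
        then show ?thesis
          using Suc.prems by (intro exI[of _ n]) simp
      qed
    qed simp
    then show ?thesis
      by blast
  qed
  ultimately show ?thesis
    unfolding explorer_guarantees_def by blast
qed

theorem theorem2p2:
  fixes G :: "('a, 'b) pre_digraph"
  assumes "graph G"
    and "verts G \<noteq> {}"
    and "Digraph_Component.connected G"
  shows "Min (f_d G ` verts G) = Min (card ` {U. closed_set G U})"
proof -
  interpret graph G
    by (fact assms(1))
  define m where "m = Min (card ` {U. closed_set G U})"
  have fin: "finite (card ` {U. closed_set G U})"
    by (rule finite_imageI, rule finite_subset[of _ "Pow (verts G)"]) (auto simp: closed_set_def)
  have "card ` {U. closed_set G U} \<noteq> {}"
    using closed_set_verts[OF assms(2)] by auto
  then have "m \<in> card ` {U. closed_set G U}"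
    using Min_in[OF fin] by (simp add: m_def)
  then obtain U where U: "closed_set G U" "m = card U"
    by auto
  have large: "m \<le> card U'" if "closed_set G U'" for U'
    unfolding m_def using fin that by (intro Min_le) auto
  \<comment> \<open>The full vertex set is closed, hence bounds every guaranteed number; this makes
    the \<open>Max\<close> in \<open>f_d\<close> meaningful.\<close>
  have fin_k: "finite {k. explorer_guarantees G v k}" if "v \<in> verts G" for v
    by (rule finite_subset[of _ "{..card (verts G)}"])
      (auto intro: explorer_guarantees_le_card_closed[OF closed_set_verts[OF assms(2)] finite_verts that])
  have m_k: "explorer_guarantees G v m" if "v \<in> verts G" for v
    using explorer_guarantees_if_no_smaller_closed[OF finite_verts that large] .
  have lower: "m \<le> f_d G v" if "v \<in> verts G" for v
    unfolding f_d_def using fin_k m_k that by (intro Max_ge) auto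
  \<comment> \<open>Any start inside the minimum closed set \<open>U\<close> attains the lower bound
    \<open>m\<close>.\<close>
  obtain u where u: "u \<in> U" "u \<in> verts G"
    using U(1) by (auto simp: closed_set_def)
  have "finite U"
    using U(1) by (auto simp: closed_set_def intro: finite_subset[OF _ finite_verts])
  then have "f_d G u \<le> m"
    unfolding f_d_def U(2) using fin_k[OF u(2)] m_k[OF u(2)] u(1) U(1)
    by (subst Max_le_iff) (auto intro: explorer_guarantees_le_card_closed)
  then have "f_d G u = m"
    using lower[OF u(2)] by simp
  then have "Min (f_d G ` verts G) = m"
    using lower u(2) by (intro Min_eqI) auto
  then show ?thesis
    by (simp add: m_def)
qed

end
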